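(* Let $R$ be a finite noncommutative ring such that $|R|\notin\{8,12\}$, and let $r\in K(R)$. Then $\Delta_R^r$ is $2$-regular if and only if $r=0$ and $R$ is isomorphic to $E(4)$ or $F(4)$.
   Context: Rings are associative and not assumed to have a unity. $[x,y]:=xy-yx$ and $K(R):=\{[x,y]:x,y\in R\}$. $Z(R)$ is the center of $R$. $\Delta_R^r$ is the simple undirected graph with vertex set $R\setminus Z(R)$ in which two distinct vertices $x,y$ are adjacent if and only if $[x,y]\neq r$ and $[x,y]\neq -r$. For a prime $p$, $E(p^2)=\langle a,b: pa=pb=0,\ a^2=a,\ b^2=b,\ ab=a,\ ba=b\rangle$ and $F(p^2)=\langle x,y: px=py=0,\ x^2=x,\ y^2=y,\ xy=y,\ yx=x\rangle$; these are (non-unital) rings of order $p^2$ whose additive group is free over $\mathbb{Z}/p$ on the two generators, with multiplication determined bilinearly by the given relations. *)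

theory Defs
  imports Main "HOL-Library.Numeral_Type"
begin

text \<open>
  The type class \<^class>\<open>ring\<close> is the library's class of associative rings that need not have a unity,
  and is used with \<^class>\<open>finite\<close> for finite rings; the carrier is the whole type.
\<close>

definition commutator :: "'a::ring \<Rightarrow> 'a \<Rightarrow> 'a" where
  "commutator x y = x * y - y * x"

definition commutators :: "'a::ring set" where
  "commutators = {commutator x y | x y. True}"

definition ring_center :: "'a::ring set" where
  "ring_center = {z. \<forall>x. z * x = x * z}"

text \<open>A simple undirected graph is a set of vertices together with a set of two-element edges.\<close>

type_synonym 'a sgraph = "'a set \<times> 'a set set"

definition noncommuting_graph :: "'a::ring \<Rightarrow> 'a sgraph" where
  "noncommuting_graph r =
    (UNIV - ring_center,
     {{x, y} | x y. x \<in> UNIV - ring_center \<and> y \<in> UNIV - ring_center \<and> x \<noteq> y \<and>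
        commutator x y \<noteq> r \<and> commutator x y \<noteq> - r})"

definition graph_degree :: "'a sgraph \<Rightarrow> 'a \<Rightarrow> nat" where
  "graph_degree G v = card {e \<in> snd G. v \<in> e}"

definition regular_graph :: "nat \<Rightarrow> 'a sgraph \<Rightarrow> bool" where
  "regular_graph k G \<longleftrightarrow> (\<forall>v \<in> fst G. graph_degree G v = k)"

definition is_ring_iso :: "('a::ring \<Rightarrow> 'b::ring) \<Rightarrow> bool" where
  "is_ring_iso f \<longleftrightarrow> bij f \<and> (\<forall>x y. f (x + y) = f x + f y) \<and> (\<forall>x y. f (x * y) = f x * f y)"

text \<open>
  The coefficient ring \<open>'k\<close> is a type parameter. With \<open>'k\<close> the numeral type \<open>p\<close> of the library,
  i.e. the integers modulo \<open>p\<close>, the following type is \<open>E(p\<^sup>2)\<close>;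
  \<open>E_elem i j\<close> stands for \<open>i a + j b\<close>. The product is the bilinear extension of
  \<open>a\<^sup>2 = a\<close>, \<open>b\<^sup>2 = b\<close>, \<open>ab = a\<close>, \<open>ba = b\<close>:
  \<open>(i a + j b) (k a + l b) = (ik + il) a + (jk + jl) b\<close>.
\<close>

datatype 'k E_ring = E_elem (E_a: 'k) (E_b: 'k)

instantiation E_ring :: (comm_ring_1) ring
begin

definition "0 = E_elem 0 0"
definition "u + v = E_elem (E_a u + E_a v) (E_b u + E_b v)"
definition "- u = E_elem (- E_a u) (- E_b u)"
definition "u - v = E_elem (E_a u - E_a v) (E_b u - E_b v)"
definition "u * v = E_elem (E_a u * E_a v + E_a u * E_b v) (E_b u * E_a v + E_b u * E_b v)"

instance
  by standard
    (auto simp: zero_E_ring_def plus_E_ring_def uminus_E_ring_def minus_E_ring_def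
      times_E_ring_def algebra_simps intro: E_ring.expand)

end

text \<open>
  Similarly for \<open>F(p\<^sup>2)\<close>: \<open>F_elem i j\<close> stands for \<open>i x + j y\<close>, and the relations
  \<open>x\<^sup>2 = x\<close>, \<open>y\<^sup>2 = y\<close>, \<open>xy = y\<close>, \<open>yx = x\<close> give
  \<open>(i x + j y) (k x + l y) = (ik + jk) x + (il + jl) y\<close>.
\<close>

datatype 'k F_ring = F_elem (F_x: 'k) (F_y: 'k)

instantiation F_ring :: (comm_ring_1) ring
begin

definition "0 = F_elem 0 0"
definition "u + v = F_elem (F_x u + F_x v) (F_y u + F_y v)"
definition "- u = F_elem (- F_x u) (- F_y u)"
definition "u - v = F_elem (F_x u - F_x v) (F_y u - F_y v)"
definition "u * v = F_elem (F_x u * F_x v + F_y u * F_x v) (F_x u * F_y v + F_y u * F_y v)"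

instance
  by standard
    (auto simp: zero_F_ring_def plus_F_ring_def uminus_F_ring_def minus_F_ring_def
      times_F_ring_def algebra_simps intro: F_ring.expand)

end

lemma E_ring_relations:
  fixes a b :: "'k::comm_ring_1 E_ring"
  defines "a \<equiv> E_elem 1 0" and "b \<equiv> E_elem 0 1"
  shows "a * a = a" "b * b = b" "a * b = a" "b * a = b"
  by (simp_all add: a_def b_def times_E_ring_def)

lemma F_ring_relations:
  fixes x y :: "'k::comm_ring_1 F_ring"
  defines "x \<equiv> F_elem 1 0" and "y \<equiv> F_elem 0 1"
  shows "x * x = x" "y * y = y" "x * y = y" "y * x = x"
  by (simp_all add: x_def y_def times_F_ring_def)

lemma card_E_ring: "card (UNIV :: 'k::finite E_ring set) = CARD('k) ^ 2"
proof -
  have "bij_betw (\<lambda>(i, j). E_elem i j) (UNIV :: ('k \<times> 'k) set) UNIV"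
    by (rule bij_betw_byWitness[where f' = "\<lambda>u. (E_a u, E_b u)"]) auto
  from bij_betw_same_card[OF this] show ?thesis
    by (simp add: power2_eq_square)
qed

lemma card_F_ring: "card (UNIV :: 'k::finite F_ring set) = CARD('k) ^ 2"
proof -
  have "bij_betw (\<lambda>(i, j). F_elem i j) (UNIV :: ('k \<times> 'k) set) UNIV"
    by (rule bij_betw_byWitness[where f' = "\<lambda>u. (F_x u, F_y u)"]) auto
  from bij_betw_same_card[OF this] show ?thesis
    by (simp add: power2_eq_square)
qed

end

theory Submission imports Defs
begin

text \<open>
  A vertex \<open>x\<close> has \<open>|R| - |C(x)|\<close> neighbours if \<open>r = 0\<close>, and
  \<open>|R| - |Z(R)| - 1 - k |C(x)|\<close> with \<open>k \<in> {0, 1, 2}\<close> otherwise, because the solutions \<open>y\<close> of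
  \<open>[x, y] = \<plusminus>r\<close> form cosets of the centralizer \<open>C(x)\<close>. If \<open>r = 0\<close>, Lagrange's theorem
  turns degree two into \<open>|R| = 4\<close>, and a noncommutative ring of order four contains two
  idempotents spanning \<open>E(4)\<close> or \<open>F(4)\<close>. If \<open>r \<noteq> 0\<close>, Lagrange's theorem
  forces \<open>|Z(R)|\<close> to divide three and leaves, beyond the orders 8 and 12, only
  \<open>|R| = 6 |Z(R)| = 3 |C(x)|\<close>; then all commutators are killed both by 2 and by 3.
\<close>

section \<open>Commutators, centralizers and additive subgroups\<close>

text \<open>Phrased as the kernel of the additive map \<open>commutator x\<close>, whose fibres are
  then its translates.\<close>

definition centralizer :: "'a::ring \<Rightarrow> 'a set" where
  "centralizer x = {y. commutator x y = 0}"

lemma commutator_add_right: "commutator x (y + z) = commutator x y + commutator x z"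
  and commutator_diff_right: "commutator x (y - z) = commutator x y - commutator x z"
  and commutator_minus_right: "commutator x (- y) = - commutator x y"
  and commutator_add_left: "commutator (x + y) z = commutator x z + commutator y z"
  and commutator_zero_right [simp]: "commutator x 0 = 0"
  and commutator_self [simp]: "commutator x x = 0"
  by (simp_all add: commutator_def algebra_simps)

lemma commutator_swap: "commutator y x = - commutator x y"
  by (simp add: commutator_def)

lemma commutator_eq_0_sym: "commutator x y = 0 \<longleftrightarrow> commutator y x = 0"
  by (auto simp: commutator_def)

lemma ring_center_iff: "z \<in> ring_center \<longleftrightarrow> (\<forall>x. commutator z x = 0)"
  by (auto simp: ring_center_def commutator_def)

lemma ring_center_iff': "z \<in> ring_center \<longleftrightarrow> (\<forall>x. commutator x z = 0)"
  by (simp add: ring_center_iff commutator_eq_0_sym[of z])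

definition add_subgroup :: "'a::ab_group_add set \<Rightarrow> bool" where
  "add_subgroup H \<longleftrightarrow> 0 \<in> H \<and> (\<forall>x\<in>H. \<forall>y\<in>H. x - y \<in> H)"

lemma add_subgroup_UNIV: "add_subgroup UNIV"
  by (simp add: add_subgroup_def)

lemma add_subgroup_centralizer: "add_subgroup (centralizer x)"
  by (simp add: add_subgroup_def centralizer_def commutator_diff_right)

lemma add_subgroup_ring_center: "add_subgroup ring_center"
  by (simp add: add_subgroup_def ring_center_iff' commutator_diff_right)

text \<open>The translates of H by elements of G partition G into blocks of size |H|.
  \<open>G\<close> is any finite subgroup, since the centre is also compared with
  centralizers.\<close>

lemma card_add_subgroup_dvd:
  fixes G H :: "'a::ab_group_add set"
  assumes H: "add_subgroup H" and G: "add_subgroup G" and "H \<subseteq> G" and fin: "finite G"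
  shows "card H dvd card G"
proof -
  let ?C = "(\<lambda>g. (+) g ` H) ` G"
  have uminus: "- x \<in> K" if "add_subgroup K" "x \<in> K" for K and x :: 'a
    using that unfolding add_subgroup_def by (metis diff_0)
  have add: "x + y \<in> K" if "add_subgroup K" "x \<in> K" "y \<in> K" for K and x y :: 'a
    using that uminus[OF that(1) that(3)] unfolding add_subgroup_def
    by (metis diff_minus_eq_add)
  have G_eq: "G = \<Union> ?C"
  proof
    show "G \<subseteq> \<Union> ?C"
    proof
      fix g assume "g \<in> G"
      moreover have "g \<in> (+) g ` H"
        using H by (force simp: add_subgroup_def image_iff)
      ultimately show "g \<in> \<Union> ?C" by blast
    qed
    show "\<Union> ?C \<subseteq> G"
      using add[OF G] \<open>H \<subseteq> G\<close> by auto
  qed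
  \<comment> \<open>A coset is determined by any of its elements, so two cosets that meet
    coincide.\<close>
  have coset_eq: "(+) g ` H = (+) x ` H" if x: "x \<in> (+) g ` H" for g x
  proof -
    obtain h where h: "h \<in> H" "x = g + h" using x by blast
    have "(+) g ` H \<subseteq> (+) x ` H"
    proof
      fix z assume "z \<in> (+) g ` H"
      then obtain h' where "h' \<in> H" "z = g + h'" by blast
      then have "z = x + (h' - h)" "h' - h \<in> H"
        using H h by (auto simp: add_subgroup_def)
      then show "z \<in> (+) x ` H" by blast
    qed
    moreover have "(+) x ` H \<subseteq> (+) g ` H"
      using h add[OF H] by (auto simp: add.assoc)
    ultimately show ?thesis by blast
  qed
  have "card H dvd card (\<Union> ?C)"
  proof (rule dvd_partition)
    show "finite (\<Union> ?C)" using G_eq fin by simp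
    show "\<forall>c\<in>?C. card H dvd card c" by (auto simp: card_image)
    show "\<forall>c1\<in>?C. \<forall>c2\<in>?C. c1 \<noteq> c2 \<longrightarrow> c1 \<inter> c2 = {}"
    proof (intro ballI impI, rule ccontr)
      fix c1 c2
      assume "c1 \<in> ?C" "c2 \<in> ?C" and ne: "c1 \<noteq> c2" and "c1 \<inter> c2 \<noteq> {}"
      then obtain g1 g2 x where c: "c1 = (+) g1 ` H" "c2 = (+) g2 ` H" and "x \<in> c1" "x \<in> c2"
        by blast
      then have "c1 = (+) x ` H" "c2 = (+) x ` H"
        using coset_eq[of x g1] coset_eq[of x g2] by (simp_all only: c)
      then show False using ne by simp
    qed
  qed
  then show ?thesis using G_eq by simp
qed

section \<open>Fibres and images of commutator maps\<close>

text \<open>Adding the particular solution \<open>y\<close> carries the kernel of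
  \<open>commutator x\<close> onto its fibre over \<open>s\<close>.\<close>

lemma card_fibre:
  assumes "commutator x y = s"
  shows "card {z. commutator x z = s} = card (centralizer x)"
proof -
  have "bij_betw ((+) y) (centralizer x) {z. commutator x z = s}"
    using assms
    by (intro bij_betw_byWitness[where f' = "\<lambda>z. z - y"])
      (auto simp: centralizer_def commutator_add_right commutator_diff_right)
  then show ?thesis by (metis bij_betw_same_card)
qed

lemma card_range_times_centralizer:
  fixes x :: "'a::{ring, finite}"
  shows "CARD('a) = card (range (commutator x)) * card (centralizer x)"
proof -
  have "CARD('a) = (\<Sum>s\<in>range (commutator x). card {z. commutator x z = s})"
    using sum.image_gen[of UNIV "\<lambda>_. 1::nat" "commutator x"] by simp
  also have "\<dots> = (\<Sum>s\<in>range (commutator x). card (centralizer x))"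
    by (rule sum.cong) (auto intro: card_fibre)
  finally show ?thesis by simp
qed

text \<open>Translation by \<open>[x, y]\<close> permutes the image of \<open>[x, \<cdot>]\<close>, so it preserves the sum of the image.\<close>

lemma three_times_commutator:
  fixes x y :: "'a::{ring, finite}"
  assumes "CARD('a) = 3 * card (centralizer x)"
  shows "commutator x y + commutator x y + commutator x y = 0"
proof -
  let ?I = "range (commutator x)" and ?c = "commutator x y"
  have "card (centralizer x) \<noteq> 0" using assms zero_less_card_finite by (metis mult_0_right less_irrefl)
  then have card: "card ?I = 3" using card_range_times_centralizer[of x] assms by simp
  have "bij_betw (\<lambda>s. s + ?c) ?I ?I"
  proof (rule bij_betw_byWitness[where f' = "\<lambda>s. s - ?c"])
    show "(\<lambda>s. s + ?c) ` ?I \<subseteq> ?I" "(\<lambda>s. s - ?c) ` ?I \<subseteq> ?I"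
      by (auto simp flip: commutator_add_right commutator_diff_right)
  qed auto
  then have "(\<Sum>s\<in>?I. s + ?c) = (\<Sum>s\<in>?I. s)"
    by (rule sum.reindex_bij_betw)
  then have "(\<Sum>s\<in>?I. ?c) = 0" by (simp add: sum.distrib)
  moreover obtain u v w where "?I = {u, v, w}" "u \<noteq> v" "u \<noteq> w" "v \<noteq> w"
    using card by (auto simp: card_3_iff)
  ultimately show ?thesis by (simp add: add.assoc)
qed

text \<open>With Z(R) of index two in C(x), the only cosets are Z(R) and x + Z(R); the second cannot
  contain x + x, since cancelling x would make x central.\<close>

lemma double_in_center:
  fixes x :: "'a::{ring, finite}"
  assumes "card (centralizer x) = 2 * card (ring_center :: 'a set)" and x: "x \<notin> ring_center"
  shows "x + x \<in> ring_center"
proof -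
  let ?Z = "ring_center :: 'a set"
  have disj: "?Z \<inter> (+) x ` ?Z = {}"
    using x by (auto simp: ring_center_iff commutator_add_left)
  have "?Z \<union> (+) x ` ?Z = centralizer x"
  proof (rule card_subset_eq)
    show "?Z \<union> (+) x ` ?Z \<subseteq> centralizer x"
      by (auto simp: centralizer_def commutator_add_right ring_center_iff')
    show "card (?Z \<union> (+) x ` ?Z) = card (centralizer x)"
      using assms disj by (simp add: card_Un_disjoint card_image)
  qed simp
  moreover have "x + x \<in> centralizer x"
    by (simp add: centralizer_def commutator_add_right)
  moreover have "x + x \<notin> (+) x ` ?Z" using x by auto
  ultimately show ?thesis by blast
qed

text \<open>For noncentral x, [x, y] is killed by 3 because the image of [x, .] has three elements,
  and by 2 because x + x is central.\<close>

lemma commutator_0_if_index_6: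
  fixes x y :: "'a::{ring, finite}"
  assumes "CARD('a) = 3 * card (centralizer x)"
    and "card (centralizer x) = 2 * card (ring_center :: 'a set)"
  shows "commutator x y = 0"
proof (cases "x \<in> ring_center")
  case False
  have "commutator (x + x) y = 0"
    using double_in_center[OF assms(2) False] by (simp add: ring_center_iff)
  then have "commutator x y + commutator x y = 0" by (simp add: commutator_add_left)
  then show ?thesis using three_times_commutator[OF assms(1), of y] by simp
qed (simp add: ring_center_iff)

section \<open>Vertex degrees\<close>

lemma graph_degree_noncommuting_graph:
  fixes r v :: "'a::{ring, finite}"
  assumes "v \<notin> ring_center"
  shows "graph_degree (noncommuting_graph r) v =
    card {y. y \<notin> ring_center \<and> y \<noteq> v \<and> commutator v y \<noteq> r \<and> commutator v y \<noteq> - r}"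
    (is "_ = card ?N")
proof -
  \<comment> \<open>Exchanging the arguments swaps the conditions for \<open>r\<close> and
    \<open>- r\<close>, so adjacency is symmetric.\<close>
  have swap: "commutator y v = r \<longleftrightarrow> commutator v y = - r"
    "commutator y v = - r \<longleftrightarrow> commutator v y = r" for y
    by (auto simp: commutator_swap[of y v])
  have "{e \<in> snd (noncommuting_graph r). v \<in> e} = (\<lambda>y. {v, y}) ` ?N"
    using assms by (auto simp: noncommuting_graph_def swap)
  moreover have "inj_on (\<lambda>y. {v, y}) ?N"
    by (auto simp: inj_on_def doubleton_eq_iff)
  ultimately show ?thesis by (simp add: graph_degree_def card_image)
qed

lemma regular_noncommuting_graph_iff:
  "regular_graph k (noncommuting_graph r) \<longleftrightarrow>
    (\<forall>v. v \<notin> ring_center \<longrightarrow> graph_degree (noncommuting_graph r) v = k)"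
  by (auto simp: regular_graph_def noncommuting_graph_def)

text \<open>For r = 0 the central elements and \<open>v\<close> itself already lie in C(v), so the
  neighbours of \<open>v\<close> are exactly the complement of C(v).\<close>

lemma degree_plus_centralizer:
  fixes v :: "'a::{ring, finite}"
  assumes "v \<notin> ring_center"
  shows "graph_degree (noncommuting_graph 0) v + card (centralizer v) = CARD('a)"
proof -
  have "{y. y \<notin> ring_center \<and> y \<noteq> v \<and> commutator v y \<noteq> 0 \<and> commutator v y \<noteq> - 0} = - centralizer v"
    by (auto simp: centralizer_def ring_center_iff')
  then show ?thesis
    using graph_degree_noncommuting_graph[OF assms, of 0] card_mono[of UNIV "centralizer v"]
    by (simp add: Compl_eq_Diff_UNIV card_Diff_subset)
qed

text \<open>Outside the neighbourhood of \<open>v\<close> lie the centre, \<open>v\<close> and the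
  fibres of [v, .] over \<open>r\<close> and \<open>- r\<close>. The fibres avoid the centre and
  \<open>v\<close>, where [v, .] vanishes, because \<open>r\<close> is nonzero. \<open>k\<close>
  counts the distinct nonempty fibres.\<close>

lemma card_eq_degree_sum:
  fixes r v :: "'a::{ring, finite}"
  assumes v: "v \<notin> ring_center" and r: "r \<noteq> 0"
  obtains k where "k \<le> 2" "r \<in> range (commutator v) \<Longrightarrow> k \<noteq> 0"
    "CARD('a) = graph_degree (noncommuting_graph r) v + card (ring_center :: 'a set) + 1
      + k * card (centralizer v)"
proof -
  let ?N = "{y. y \<notin> ring_center \<and> y \<noteq> v \<and> commutator v y \<noteq> r \<and> commutator v y \<noteq> - r}"
  let ?T = "\<lambda>s. {y. commutator v y = s}"
  have "UNIV = ?N \<union> (ring_center \<union> ({v} \<union> (?T r \<union> ?T (- r))))" by auto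
  then have "CARD('a) = card (?N \<union> (ring_center \<union> ({v} \<union> (?T r \<union> ?T (- r)))))"
    by simp
  also have "\<dots> = card ?N + card (ring_center \<union> ({v} \<union> (?T r \<union> ?T (- r))))"
    using r by (intro card_Un_disjoint) auto
  also have "card (ring_center \<union> ({v} \<union> (?T r \<union> ?T (- r)))) =
      card (ring_center :: 'a set) + card ({v} \<union> (?T r \<union> ?T (- r)))"
    using r v by (intro card_Un_disjoint) (auto simp: ring_center_iff')
  also have "card ({v} \<union> (?T r \<union> ?T (- r))) = 1 + card (?T r \<union> ?T (- r))"
    using r by (subst card_Un_disjoint) auto
  finally have sum: "CARD('a) = graph_degree (noncommuting_graph r) v + card (ring_center :: 'a set)
      + 1 + card (?T r \<union> ?T (- r))"
    using graph_degree_noncommuting_graph[OF v, of r] by simp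
  show ?thesis
  proof (cases "r \<in> range (commutator v)")
    case False
    then have "commutator v y \<noteq> r" "commutator v y \<noteq> - r" for y
      using commutator_minus_right[of v y] by (metis rangeI minus_minus)+
    then have "?T r \<union> ?T (- r) = {}" by auto
    then show ?thesis using that[of 0] False sum by simp
  next
    case True
    then obtain y where y: "commutator v y = r" by auto
    have c1: "card (?T r) = card (centralizer v)" using y by (rule card_fibre)
    have c2: "card (?T (- r)) = card (centralizer v)"
      by (rule card_fibre[of v "- y"]) (simp add: commutator_minus_right y)
    show ?thesis
    proof (cases "r = - r")
      case True
      then have "?T r \<union> ?T (- r) = ?T r" by auto
      then show ?thesis using that[of 1] sum c1 by simp
    next
      case False
      then have "card (?T r \<union> ?T (- r)) = card (?T r) + card (?T (- r))"
        by (intro card_Un_disjoint) auto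
      then show ?thesis using that[of 2] sum c1 c2 by simp
    qed
  qed
qed

section \<open>Orders of the centre, the centralizers and the ring\<close>

lemma card_center_dvd_centralizer:
  fixes x :: "'a::{ring, finite}"
  shows "card (ring_center :: 'a set) dvd card (centralizer x)"
  by (rule card_add_subgroup_dvd[OF add_subgroup_ring_center add_subgroup_centralizer])
    (auto simp: centralizer_def ring_center_iff')

lemma card_centralizer_dvd:
  fixes x :: "'a::{ring, finite}"
  shows "card (centralizer x) dvd CARD('a)"
  by (rule card_add_subgroup_dvd[OF add_subgroup_centralizer add_subgroup_UNIV]) auto

lemma card_center_less_centralizer:
  fixes x :: "'a::{ring, finite}"
  assumes "x \<notin> ring_center"
  shows "card (ring_center :: 'a set) < card (centralizer x)"
proof (rule psubset_card_mono)
  have "x \<in> centralizer x" "ring_center \<subseteq> centralizer x"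
    by (auto simp: centralizer_def ring_center_iff')
  then show "ring_center \<subset> centralizer x" using assms by blast
qed simp

lemma card_centralizer_bounds:
  fixes x :: "'a::{ring, finite}"
  assumes "x \<notin> ring_center"
  shows "2 \<le> card (centralizer x)" "card (centralizer x) < CARD('a)"
proof -
  have "x \<noteq> 0" using assms by (auto simp: ring_center_def)
  moreover have "{0, x} \<subseteq> centralizer x" by (simp add: centralizer_def)
  ultimately show "2 \<le> card (centralizer x)"
    using card_mono[of "centralizer x" "{0, x}"] by simp
  show "card (centralizer x) < CARD('a)"
    using assms by (intro psubset_card_mono) (auto simp: centralizer_def ring_center_iff)
qed

lemma nat_dvd_4: "d dvd 4 \<Longrightarrow> d \<in> {1, 2, 4}" for d :: nat
proof -
  assume d: "d dvd 4"
  then have "d \<le> 4" by (simp add: dvd_imp_le)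
  then have "d \<in> {0, 1, 2, 3, 4}" by auto
  then show ?thesis using d by auto
qed

lemma nat_dvd_6: "d dvd 6 \<Longrightarrow> d \<in> {1, 2, 3, 6}" for d :: nat
proof -
  assume d: "d dvd 6"
  then have "d \<le> 6" by (simp add: dvd_imp_le)
  then have "d \<in> {0, 1, 2, 3, 4, 5, 6}" by auto
  then show ?thesis using d by auto
qed

lemma nat_dvd_3: "d dvd 3 \<Longrightarrow> d \<in> {1, 3}" for d :: nat
proof -
  assume d: "d dvd 3"
  then have "d \<le> 3" by (simp add: dvd_imp_le)
  then have "d \<in> {0, 1, 2, 3}" by auto
  then show ?thesis using d by auto
qed

text \<open>Read n, z, c as the orders of R, Z(R), C(x). As c divides n it divides z + 3, so z
  divides 3. If z = 1, then c is 2 or 4 and n is 6, 8 or 12; if z = 3, then c = 6 and n is 12 or 18.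
  Both 6 and 18 have the stated shape.\<close>

lemma orders_of_regular_ring:
  fixes n z c k :: nat
  assumes n: "n = z + 3 + k * c" and k: "k = 1 \<or> k = 2"
    and zc: "z dvd c" and cn: "c dvd n" and "z < c" and "n \<notin> {8, 12}"
  shows "n = 3 * c \<and> c = 2 * z"
proof -
  have cz: "c dvd z + 3" using cn n dvd_add_left_iff[of c "k * c" "z + 3"] by simp
  then have "z dvd z + 3" using zc dvd_trans by blast
  then have "z dvd 3" by simp
  then have "z = 1 \<or> z = 3" using nat_dvd_3 by blast
  then show ?thesis
  proof
    assume z: "z = 1"
    then have "c \<in> {1, 2, 4}" using nat_dvd_4[of c] cz by simp
    then show ?thesis using z k assms(5,6) n by auto
  next
    assume z: "z = 3"
    then have "c \<in> {1, 2, 3, 6}" using nat_dvd_6[of c] cz by simp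
    then show ?thesis using z k assms(5,6) n by auto
  qed
qed

section \<open>Consequences of 2-regularity\<close>

text \<open>Writing a nonzero r as [x, y] makes x a vertex with \<open>k\<close> at least 1; the
  arithmetic leaves only |R| = 3 |C(x)| = 6 |Z(R)|, where [x, y] = 0.\<close>

lemma regular_imp_zero:
  fixes r :: "'a::{ring, finite}"
  assumes reg: "regular_graph 2 (noncommuting_graph r)"
    and "CARD('a) \<notin> {8, 12}" and "r \<in> commutators"
  shows "r = 0"
proof (rule ccontr)
  assume r: "r \<noteq> 0"
  obtain x y where xy: "commutator x y = r" using \<open>r \<in> commutators\<close> by (auto simp: commutators_def)
  then have x: "x \<notin> ring_center" using r by (auto simp: ring_center_iff)
  \<comment> \<open>The summand 3 is the degree 2 plus one for \<open>x\<close> itself.\<close>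
  obtain k where k: "k \<le> 2" "k \<noteq> 0"
    and card: "CARD('a) = card (ring_center :: 'a set) + 3 + k * card (centralizer x)"
  proof -
    have deg: "graph_degree (noncommuting_graph r) x = 2"
      using reg x by (simp add: regular_noncommuting_graph_iff)
    have "r \<in> range (commutator x)" using xy by blast
    with card_eq_degree_sum[OF x r] obtain k where "k \<le> 2" "k \<noteq> 0"
      "CARD('a) = 2 + card (ring_center :: 'a set) + 1 + k * card (centralizer x)"
      unfolding deg by metis
    then show thesis using that by simp
  qed
  have "k = 1 \<or> k = 2" using k by auto
  from orders_of_regular_ring[OF card this card_center_dvd_centralizer card_centralizer_dvd
      card_center_less_centralizer[OF x] assms(2)]
  have "commutator x y = 0" using commutator_0_if_index_6 by blast
  then show False using xy r by simp
qed

text \<open>The order is 2 + |C(x)| and a multiple of |C(x)|, so |C(x)| divides 2; it is not 1,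
  because C(x) contains 0 and the nonzero x.\<close>

lemma regular_zero_imp_card_4:
  fixes x y :: "'a::{ring, finite}"
  assumes reg: "regular_graph 2 (noncommuting_graph (0 :: 'a))" and xy: "x * y \<noteq> y * x"
  shows "CARD('a) = 4"
proof -
  have x: "x \<notin> ring_center" using xy by (auto simp: ring_center_def)
  have card: "CARD('a) = 2 + card (centralizer x)"
    using degree_plus_centralizer[OF x] reg x by (simp add: regular_noncommuting_graph_iff)
  then have "card (centralizer x) dvd 2"
    using card_centralizer_dvd[of x] dvd_add_left_iff[OF dvd_refl] by metis
  then have "card (centralizer x) \<le> 2" by (simp add: dvd_imp_le)
  then show ?thesis using card card_centralizer_bounds(1)[OF x] by simp
qed

lemma card_centralizer_order_4:
  fixes x :: "'a::{ring, finite}"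
  assumes "CARD('a) = 4" and "x \<notin> ring_center"
  shows "card (centralizer x) = 2"
  using nat_dvd_4[of "card (centralizer x)"] card_centralizer_dvd[of x]
    card_centralizer_bounds[OF assms(2)] assms(1) by auto

lemma card_4_imp_regular:
  assumes "CARD('a::{ring, finite}) = 4"
  shows "regular_graph 2 (noncommuting_graph (0 :: 'a))"
  unfolding regular_noncommuting_graph_iff
proof (intro allI impI)
  fix v :: 'a
  assume "v \<notin> ring_center"
  from degree_plus_centralizer[OF this] card_centralizer_order_4[OF assms this] assms
  show "graph_degree (noncommuting_graph 0) v = 2" by simp
qed

lemma centralizer_order_4:
  fixes x :: "'a::{ring, finite}"
  assumes "CARD('a) = 4" and x: "x \<notin> ring_center"
  shows "centralizer x = {0, x}"
proof -
  have "x \<noteq> 0" using x by (auto simp: ring_center_def)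
  then have "{0, x} = centralizer x"
    using card_centralizer_order_4[OF assms]
    by (intro card_subset_eq) (auto simp: centralizer_def)
  then show ?thesis by simp
qed

section \<open>Coordinates over the integers modulo 2\<close>

lemma two_elements: "i = 0 \<or> i = 1" for i :: 2
proof -
  have "{0, 1 :: 2} = UNIV" by (rule card_subset_eq) simp_all
  then show ?thesis by blast
qed

lemma one_plus_one_2: "1 + 1 = (0 :: 2)"
  using two_elements[of "1 + 1"] by auto

text \<open>Isomorphisms are built from coordinates into R, while the theorem asks for maps out of
  R.\<close>

lemma is_ring_iso_inv:
  assumes "is_ring_iso g"
  shows "is_ring_iso (inv g)"
proof -
  have g: "bij g" "\<And>x y. g (x + y) = g x + g y" "\<And>x y. g (x * y) = g x * g y"
    using assms unfolding is_ring_iso_def by blast+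
  have inv: "inv g (g u) = u" "g (inv g v) = v" for u v
    using g(1) by (simp_all add: bij_def surj_f_inv_f)
  have "inv g (x + y) = inv g x + inv g y" "inv g (x * y) = inv g x * inv g y" for x y
    using g(2,3)[of "inv g x" "inv g y"] inv by metis+
  then show ?thesis using g(1) by (simp add: is_ring_iso_def bij_imp_bij_inv)
qed

text \<open>The map \<open>g\<close> evaluates coordinates at a and b. The listing of the elements
  makes it onto, equal orders make it bijective, and the relations match those of E(4).\<close>

lemma iso_E_ring_if_relations:
  fixes a b :: "'a::{ring, finite}"
  assumes U: "UNIV = {0, a, b, a + b}" and card: "CARD('a) = 4"
    and char: "a + a = 0" "b + b = 0"
    and rel: "a * a = a" "b * b = b" "a * b = a" "b * a = b"
  shows "\<exists>f :: 'a \<Rightarrow> 2 E_ring. is_ring_iso f"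
proof -
  \<comment> \<open>\<open>s\<close> is scalar multiplication by integers modulo 2; its additivity
    in \<open>i\<close> rests on u + u = 0.\<close>
  define s :: "2 \<Rightarrow> 'a \<Rightarrow> 'a" where "s i u = (if i = 0 then 0 else u)" for i u
  define g where "g u = s (E_a u) a + s (E_b u) b" for u
  have s: "s 0 u = 0" "s 1 u = u" for u by (simp_all add: s_def)
  have s_add: "s (i + j) u = s i u + s j u" if "u + u = 0" for i j u
    using two_elements[of i] two_elements[of j] that
    by (auto simp: s one_plus_one_2 simp del: one_add_one)
  have s_mult: "s (i * j) (u * v) = s i u * s j v" for i j u v
    using two_elements[of i] two_elements[of j] by (auto simp: s)
  have "surj g"
  proof -
    have "{0, a, b, a + b} \<subseteq> g ` {E_elem 0 0, E_elem 1 0, E_elem 0 1, E_elem 1 1}"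
      by (simp add: g_def s)
    then show ?thesis using U by auto
  qed
  moreover have "card (range g) = CARD(2 E_ring)"
    using \<open>surj g\<close> card by (simp add: card_E_ring)
  moreover have "finite (UNIV :: 2 E_ring set)"
    by (rule card_ge_0_finite) (simp add: card_E_ring)
  ultimately have "bij g" by (simp add: bij_def eq_card_imp_inj_on)
  moreover have "g (u + v) = g u + g v" for u v
    by (simp add: g_def plus_E_ring_def s_add char algebra_simps)
  moreover have "g (u * v) = g u * g v" for u v
    using s_mult[of "E_a u" "E_a v" a a] s_mult[of "E_a u" "E_b v" a b]
      s_mult[of "E_b u" "E_a v" b a] s_mult[of "E_b u" "E_b v" b b]
    by (simp add: g_def times_E_ring_def s_add char rel algebra_simps)
  ultimately have "is_ring_iso g" by (simp add: is_ring_iso_def)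
  then show ?thesis using is_ring_iso_inv by blast
qed

text \<open>F(4) is the opposite ring of E(4), so the same coordinates work with the two mixed
  products exchanged.\<close>

lemma iso_F_ring_if_relations:
  fixes a b :: "'a::{ring, finite}"
  assumes U: "UNIV = {0, a, b, a + b}" and card: "CARD('a) = 4"
    and char: "a + a = 0" "b + b = 0"
    and rel: "a * a = a" "b * b = b" "a * b = b" "b * a = a"
  shows "\<exists>f :: 'a \<Rightarrow> 2 F_ring. is_ring_iso f"
proof -
  define s :: "2 \<Rightarrow> 'a \<Rightarrow> 'a" where "s i u = (if i = 0 then 0 else u)" for i u
  define g where "g u = s (F_x u) a + s (F_y u) b" for u
  have s: "s 0 u = 0" "s 1 u = u" for u by (simp_all add: s_def)
  have s_add: "s (i + j) u = s i u + s j u" if "u + u = 0" for i j u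
    using two_elements[of i] two_elements[of j] that
    by (auto simp: s one_plus_one_2 simp del: one_add_one)
  have s_mult: "s (i * j) (u * v) = s i u * s j v" for i j u v
    using two_elements[of i] two_elements[of j] by (auto simp: s)
  have "surj g"
  proof -
    have "{0, a, b, a + b} \<subseteq> g ` {F_elem 0 0, F_elem 1 0, F_elem 0 1, F_elem 1 1}"
      by (simp add: g_def s)
    then show ?thesis using U by auto
  qed
  moreover have "card (range g) = CARD(2 F_ring)"
    using \<open>surj g\<close> card by (simp add: card_F_ring)
  moreover have "finite (UNIV :: 2 F_ring set)"
    by (rule card_ge_0_finite) (simp add: card_F_ring)
  ultimately have "bij g" by (simp add: bij_def eq_card_imp_inj_on)
  moreover have "g (u + v) = g u + g v" for u v
    by (simp add: g_def plus_F_ring_def s_add char algebra_simps)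
  moreover have "g (u * v) = g u * g v" for u v
    using s_mult[of "F_x u" "F_x v" a a] s_mult[of "F_x u" "F_y v" a b]
      s_mult[of "F_y u" "F_x v" b a] s_mult[of "F_y u" "F_y v" b b]
    by (simp add: g_def times_F_ring_def s_add char rel algebra_simps)
  ultimately have "is_ring_iso g" by (simp add: is_ring_iso_def)
  then show ?thesis using is_ring_iso_inv by blast
qed

section \<open>Structure of noncommutative rings of order four\<close>

context
  assumes card_4: "CARD('a::{ring, finite}) = 4"
begin

lemma elements:
  fixes x y :: 'a
  assumes "x * y \<noteq> y * x"
  shows "UNIV = {0, x, y, x + y}"
proof -
  have "x \<noteq> 0" "y \<noteq> 0" "x \<noteq> y" "x + y \<noteq> 0"
    using assms by (auto simp: eq_neg_iff_add_eq_0[symmetric])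
  then have c: "card {0, x, y, x + y} = 4" by auto
  show "UNIV = {0, x, y, x + y}"
    using card_subset_eq[of UNIV "{0, x, y, x + y}"] c card_4 by simp
qed

text \<open>\<open>y\<close> shows that x is noncentral, so C(x) has just two elements. In
  particular x + x and x * x are each 0 or x.\<close>

lemma commuting_iff:
  fixes x y z :: 'a
  assumes "x * y \<noteq> y * x"
  shows "x * z = z * x \<longleftrightarrow> z = 0 \<or> z = x"
proof -
  have "x \<notin> ring_center" using assms by (auto simp: ring_center_def)
  from centralizer_order_4[OF card_4 this] show ?thesis
    by (auto simp: centralizer_def commutator_def set_eq_iff)
qed

lemma double_eq_0:
  fixes x y :: 'a
  assumes "x * y \<noteq> y * x"
  shows "x + x = 0"
  using commuting_iff[OF assms, of "x + x"] by (auto simp: algebra_simps)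

lemma square_cases:
  fixes x y :: 'a
  assumes "x * y \<noteq> y * x"
  shows "x * x = 0 \<or> x * x = x"
  using commuting_iff[OF assms, of "x * x"] by (simp add: mult.assoc)

lemma noncommuting_add:
  fixes x y :: 'a
  assumes "x * y \<noteq> y * x"
  shows "x * (x + y) \<noteq> (x + y) * x"
  using assms by (auto simp: algebra_simps)

text \<open>Otherwise y * y = 0 too. Then x * y is annihilated by x on the left and by y on the
  right; whichever of the four elements it equals, this forces x * y = 0. Likewise y * x = 0, so x
  and y would commute.\<close>

lemma nilpotent_imp_idempotent:
  fixes x y :: 'a
  assumes xy: "x * y \<noteq> y * x" and x: "x * x = 0"
  shows "y * y = y"
proof (rule ccontr)
  assume "y * y \<noteq> y"
  then have y: "y * y = 0" using square_cases[of y x] xy by metis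
  have 1: "x * (x * y) = 0" "(x * y) * y = 0" "y * (y * x) = 0" "(y * x) * x = 0"
    using x y by (simp_all flip: mult.assoc) (simp_all add: mult.assoc x y)
  have el: "w = 0 \<or> w = x \<or> w = y \<or> w = x + y" for w
    using elements[OF xy] by blast
  have "x * y = 0"
    using el[of "x * y"] 1(1,2) x y by (auto simp: distrib_left distrib_right)
  moreover have "y * x = 0"
    using el[of "y * x"] 1(3,4) x y by (auto simp: distrib_left distrib_right)
  ultimately show False using xy by simp
qed

text \<open>No two of x, y and x + y commute, so at most one of them squares to zero and the others
  are idempotent.\<close>

lemma idempotent_pair:
  fixes x y :: 'a
  assumes xy: "x * y \<noteq> y * x"
  obtains a b :: 'a where "a * b \<noteq> b * a" "a * a = a" "b * b = b"
proof (cases "x * x = x")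
  case True
  show ?thesis
  proof (cases "y * y = y")
    case True
    then show ?thesis using that[of x y] xy \<open>x * x = x\<close> by blast
  next
    case False
    then have "y * y = 0" using square_cases[of y x] xy by metis
    then have "(y + x) * (y + x) = y + x"
      using nilpotent_imp_idempotent[of y "y + x"] noncommuting_add[of y x] xy by metis
    then show ?thesis
      using that[of x "x + y"] noncommuting_add[OF xy] True by (simp add: add.commute)
  qed
next
  case False
  then have "x * x = 0" using square_cases xy by metis
  then have "y * y = y" "(x + y) * (x + y) = x + y"
    using nilpotent_imp_idempotent[OF xy] nilpotent_imp_idempotent[OF noncommuting_add[OF xy]]
    by blast+
  moreover have "y * (x + y) \<noteq> (x + y) * y" using xy by (auto simp: algebra_simps)
  ultimately show ?thesis using that by blast
qed

lemma idempotent_product: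
  fixes a b :: 'a
  assumes ab: "a * b \<noteq> b * a" and a: "a * a = a" and b: "b * b = b"
  shows "a * b = a \<or> a * b = b"
proof -
  have a0: "a \<noteq> 0" and b0: "b \<noteq> 0" using ab by auto
  have el: "w = 0 \<or> w = a \<or> w = b \<or> w = a + b" for w
    using elements[OF ab] by blast
  have "a * b \<noteq> a + b"
  proof
    \<comment> \<open>Right multiplication by b fixes a * b but turns a + b into a * b + b, whence b
      = 0.\<close>
    assume eq: "a * b = a + b"
    have "(a * b) * b = a * b" by (simp add: mult.assoc b)
    then have "a * b + b = a * b" using eq b by (simp add: distrib_right)
    then show False using b0 by simp
  qed
  moreover have "a * b \<noteq> 0"
  proof
    assume eq: "a * b = 0"
    \<comment> \<open>The square of b * a vanishes, so b * a is neither of the nonzero idempotents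
      a, b and must be a + b; left multiplication by a then gives a = 0.\<close>
    have "(b * a) * (b * a) = b * (a * b) * a" by (simp only: mult.assoc)
    then have nil: "(b * a) * (b * a) = 0" using eq by simp
    have "b * a \<noteq> a" "b * a \<noteq> b" using nil a b a0 b0 by auto
    moreover have "b * a \<noteq> 0" using ab eq by simp
    ultimately have "b * a = a + b" using el by blast
    moreover have "a * (b * a) = 0" using eq by (simp flip: mult.assoc)
    ultimately show False using eq a a0 by (simp add: distrib_left)
  qed
  ultimately show ?thesis using el by blast
qed

lemma iso_E_or_F:
  fixes x y :: 'a
  assumes "x * y \<noteq> y * x"
  shows "(\<exists>f :: 'a \<Rightarrow> 2 E_ring. is_ring_iso f) \<or> (\<exists>f :: 'a \<Rightarrow> 2 F_ring. is_ring_iso f)"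
proof -
  obtain a b :: 'a where ab: "a * b \<noteq> b * a" and idem: "a * a = a" "b * b = b"
    using idempotent_pair[OF assms] .
  have char: "a + a = 0" "b + b = 0"
    using double_eq_0[OF ab] double_eq_0[OF ab[symmetric]] by auto
  \<comment> \<open>Both products lie in {a, b} and they differ, which leaves the relations of E(4)
    or those of F(4).\<close>
  have "a * b = a \<and> b * a = b \<or> a * b = b \<and> b * a = a"
    using idempotent_product[OF ab idem] idempotent_product[OF ab[symmetric] idem(2,1)] ab
    by auto
  then show ?thesis
    using iso_E_ring_if_relations[OF elements[OF ab] card_4 char idem]
      iso_F_ring_if_relations[OF elements[OF ab] card_4 char idem] by blast
qed

end

theorem theorem4p10:
  fixes r :: "'a::{ring, finite}"
  assumes "\<exists>x y :: 'a. x * y \<noteq> y * x"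
    and "CARD('a) \<notin> {8, 12}"
    and "r \<in> commutators"
  shows "regular_graph 2 (noncommuting_graph r) \<longleftrightarrow>
    r = 0 \<and> ((\<exists>f :: 'a \<Rightarrow> 2 E_ring. is_ring_iso f) \<or> (\<exists>f :: 'a \<Rightarrow> 2 F_ring. is_ring_iso f))"
    (is "?L \<longleftrightarrow> ?R")
proof
  assume L: ?L
  then have r: "r = 0" using assms(2,3) by (rule regular_imp_zero)
  obtain x y :: 'a where xy: "x * y \<noteq> y * x" using assms(1) by blast
  have "CARD('a) = 4" using regular_zero_imp_card_4 L r xy by blast
  then show ?R using r iso_E_or_F xy by blast
next
  assume R: ?R
  have "CARD('a) = CARD(2 E_ring) \<or> CARD('a) = CARD(2 F_ring)"
    using R by (auto simp: is_ring_iso_def dest: bij_betw_same_card)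
  then have "CARD('a) = 4" by (auto simp: card_E_ring card_F_ring)
  then show ?L using R card_4_imp_regular by auto
qed

end
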